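(* Suppose there exists a Borel-cover $\gamma$-set of reals of cardinality $\mathfrak{c}$ (the continuum). Then there exist a Borel-cover $\gamma$-set $X\subseteq 2^\omega$ and a subset $Y\subseteq X$ which is not a Borel-cover $\gamma$-set. In fact, there is an $\omega$-cover of $Y$ consisting of open subsets of $2^\omega$ which contains no $\tau$-cover of $Y$.
   Context: Sets of reals are considered as subsets of the Cantor space $2^\omega$ (identified with $P(\omega)$), with its usual product topology. An $\omega$-cover of a set $X$ is a family of sets such that every finite subset of $X$ is included in some element of the family, but $X$ itself is not a member of the family. A $\gamma$-cover of $X$ is an infinite family of sets such that every element of $X$ belongs to all but finitely many members of the family. A family $\mathcal U$ of subsets of $X$ is a $\tau$-cover of $X$ if every element of $X$ belongs to infinitely many members of $\mathcal U$ and for every $x,y\in X$ at least one of the sets $\{U\in\mathcal U: x\in U, y\notin U\}$, $\{U\in\mathcal U: x\notin U, y\in U\}$ is finite. A set $X$ is a Borel-cover $\gamma$-set if every countable $\omega$-cover of $X$ by Borel sets contains a $\gamma$-cover of $X$ (as a subfamily). *)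

theory Defs
  imports "HOL-Analysis.Analysis" "HOL-Library.Equipollence"
begin

text \<open>
  The type \<open>nat \<Rightarrow> bool\<close> carries the product of the discrete topologies on \<open>bool\<close>; a subset of
  the natural numbers is identified with its characteristic function.
\<close>

type_synonym cantor = "nat \<Rightarrow> bool"

text \<open>
  A cover of a subset \<open>X\<close> of a space is given by subsets \<open>U\<close> of the whole space; each stands for
  its trace \<open>X \<inter> U\<close>. That \<open>X\<close> itself is not a member of the cover therefore means that it is not
  one of the traces. (Demanding only \<open>X \<notin> \<U>\<close> would admit \<open>\<U> = {UNIV}\<close> for a proper
  subset \<open>X\<close>.)
\<close>

definition omega_cover :: "'a set \<Rightarrow> 'a set set \<Rightarrow> bool" where
  "omega_cover X \<U> \<longleftrightarrow>
     (\<forall>F. finite F \<and> F \<subseteq> X \<longrightarrow> (\<exists>U\<in>\<U>. F \<subseteq> U)) \<and> X \<notin> (\<lambda>U. X \<inter> U) ` \<U>"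

definition gamma_cover :: "'a set \<Rightarrow> 'a set set \<Rightarrow> bool" where
  "gamma_cover X \<U> \<longleftrightarrow> infinite \<U> \<and> (\<forall>x\<in>X. finite {U \<in> \<U>. x \<notin> U})"

definition tau_cover :: "'a set \<Rightarrow> 'a set set \<Rightarrow> bool" where
  "tau_cover X \<U> \<longleftrightarrow>
     (\<forall>x\<in>X. infinite {U \<in> \<U>. x \<in> U}) \<and>
     (\<forall>x\<in>X. \<forall>y\<in>X. finite {U \<in> \<U>. x \<in> U \<and> y \<notin> U} \<or> finite {U \<in> \<U>. x \<notin> U \<and> y \<in> U})"

definition borel_cover_gamma_set :: "'a::topological_space set \<Rightarrow> bool" where
  "borel_cover_gamma_set X \<longleftrightarrow>
     (\<forall>\<U>. countable \<U> \<and> \<U> \<subseteq> sets borel \<and> omega_cover X \<U> \<longrightarrow>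
        (\<exists>\<V>\<subseteq>\<U>. gamma_cover X \<V>))"

lemma omega_cover_subsets:
  assumes "\<U> \<subseteq> Pow X"
  shows "omega_cover X \<U> \<longleftrightarrow> (\<forall>F. finite F \<and> F \<subseteq> X \<longrightarrow> (\<exists>U\<in>\<U>. F \<subseteq> U)) \<and> X \<notin> \<U>"
proof -
  have "(\<lambda>U. X \<inter> U) ` \<U> = (\<lambda>U. U) ` \<U>"
    using assms by (intro image_cong) auto
  then show ?thesis
    by (simp add: omega_cover_def)
qed

lemma omega_cover_traces: "omega_cover X ((\<lambda>U. X \<inter> U) ` \<U>) \<longleftrightarrow> omega_cover X \<U>"
proof -
  have "(\<forall>F. finite F \<and> F \<subseteq> X \<longrightarrow> (\<exists>U\<in>(\<lambda>U. X \<inter> U) ` \<U>. F \<subseteq> U)) \<longleftrightarrow>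
        (\<forall>F. finite F \<and> F \<subseteq> X \<longrightarrow> (\<exists>U\<in>\<U>. F \<subseteq> U))"
    by auto
  moreover have "(\<lambda>U. X \<inter> U) ` (\<lambda>U. X \<inter> U) ` \<U> = (\<lambda>U. X \<inter> U) ` \<U>"
    by (simp add: image_image)
  ultimately show ?thesis
    by (simp add: omega_cover_def)
qed

text \<open>
  A family of traces that is a \<open>\<tau>\<close>-cover comes from a \<open>\<tau>\<close>-cover by subsets of the whole space, so
  containing no \<open>\<tau>\<close>-cover in the present sense is at least as strong as for families of traces.
\<close>

lemma tau_cover_traces:
  assumes "tau_cover X \<W>" "\<W> \<subseteq> (\<lambda>U. X \<inter> U) ` \<U>"
  shows "\<exists>\<V>\<subseteq>\<U>. tau_cover X \<V>"
proof -
  obtain \<V> where V: "\<V> \<subseteq> \<U>" "inj_on (\<lambda>U. X \<inter> U) \<V>" "\<W> = (\<lambda>U. X \<inter> U) ` \<V>"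
    using assms(2) by (auto simp: subset_image_inj)
  have eq: "finite {W \<in> \<W>. P W} \<longleftrightarrow> finite {U \<in> \<V>. P (X \<inter> U)}" for P
  proof -
    have "{W \<in> \<W>. P W} = (\<lambda>U. X \<inter> U) ` {U \<in> \<V>. P (X \<inter> U)}"
      using V(3) by auto
    moreover have "inj_on (\<lambda>U. X \<inter> U) {U \<in> \<V>. P (X \<inter> U)}"
      using V(2) by (rule inj_on_subset) auto
    ultimately show ?thesis
      by (simp add: finite_image_iff)
  qed
  have "tau_cover X \<V>"
    using assms(1) unfolding tau_cover_def eq by simp
  with V(1) show ?thesis by blast
qed

end

theory Submission
  imports Defs
begin

text \<open>
  Let \<open>x \<mapsto> y\<^sub>x\<close> be a continuous injection of the Cantor space onto an independent family, and let \<open>X\<close>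
  consist of all \<open>y\<^sub>x\<close> and their complements for \<open>x\<close> in the given Borel-cover \<open>\<gamma>\<close>-set \<open>Z\<close>; it is
  the union of two continuous images of \<open>Z\<close> and inherits the covering property. The set \<open>Y\<close> picks
  exactly one of \<open>y\<^sub>x\<close> and its complement for every \<open>x\<close>, so by independence the sets
  \<open>{y. n \<in> y}\<close> form an \<open>\<omega>\<close>-cover of it. As \<open>Z\<close> has size continuum, every set \<open>A\<close> of indices
  can be given two points of \<open>Z\<close> of its own, and the signs at these two points are chosen so that
  the subfamily indexed by \<open>A\<close> is not a \<open>\<tau>\<close>-cover.
\<close>

lemma gamma_cover_imp_tau_cover:
  assumes "gamma_cover X \<V>"
  shows "tau_cover X \<V>"
  unfolding tau_cover_def
proof (intro conjI ballI)
  fix x assume "x \<in> X"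
  then have "finite {U \<in> \<V>. x \<notin> U}" "infinite \<V>"
    using assms by (auto simp: gamma_cover_def)
  moreover have "\<V> = {U \<in> \<V>. x \<in> U} \<union> {U \<in> \<V>. x \<notin> U}"
    by auto
  ultimately show "infinite {U \<in> \<V>. x \<in> U}"
    by (metis finite_UnI)
next
  fix x y assume "y \<in> X"
  then have "finite {U \<in> \<V>. y \<notin> U}"
    using assms by (auto simp: gamma_cover_def)
  then show "finite {U \<in> \<V>. x \<in> U \<and> y \<notin> U} \<or> finite {U \<in> \<V>. x \<notin> U \<and> y \<in> U}"
    by (auto elim: finite_subset[rotated])
qed

text \<open>Pull each \<open>U\<close> back to the points all of whose images lie in
  \<open>U\<close>. Finiteness of \<open>I\<close> keeps these pullbacks Borel and the images of a
  finite \<open>F\<close> finite; if \<open>g i x\<close> misses \<open>U\<close>, then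
  \<open>x\<close> misses the pullback.\<close>

lemma borel_cover_gamma_set_finite_UN_image:
  fixes g :: "'i \<Rightarrow> 'a::topological_space \<Rightarrow> 'b::topological_space"
  assumes Z: "borel_cover_gamma_set Z" and "finite I"
    and g: "\<And>i. i \<in> I \<Longrightarrow> g i \<in> borel_measurable borel"
  shows "borel_cover_gamma_set (\<Union>i\<in>I. g i ` Z)"
  unfolding borel_cover_gamma_set_def
proof (intro allI impI, elim conjE)
  let ?X = "\<Union>i\<in>I. g i ` Z"
  fix \<U> assume "countable \<U>" and borel: "\<U> \<subseteq> sets borel" and cover: "omega_cover ?X \<U>"
  define P where "P U = {x. \<forall>i\<in>I. g i x \<in> U}" for U
  have "P U \<in> sets borel" if "U \<in> \<U>" for U
  proof -
    have "P U = space borel \<inter> (\<Inter>i\<in>I. g i -` U \<inter> space borel)"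
      by (auto simp: P_def)
    also have "\<dots> \<in> sets borel"
      using that g borel \<open>finite I\<close>
      by (cases "I = {}") (auto intro!: sets.finite_INT measurable_sets_borel)
    finally show ?thesis .
  qed
  moreover have "omega_cover Z (P ` \<U>)"
    unfolding omega_cover_def
  proof (intro conjI allI impI)
    fix F assume F: "finite F \<and> F \<subseteq> Z"
    then have "finite (\<Union>i\<in>I. g i ` F)" "(\<Union>i\<in>I. g i ` F) \<subseteq> ?X"
      using \<open>finite I\<close> by auto
    then obtain U where "U \<in> \<U>" "(\<Union>i\<in>I. g i ` F) \<subseteq> U"
      using cover unfolding omega_cover_def by meson
    then show "\<exists>V\<in>P ` \<U>. F \<subseteq> V"
      by (auto simp: P_def)
  next
    show "Z \<notin> (\<inter>) Z ` P ` \<U>"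
    proof
      assume "Z \<in> (\<inter>) Z ` P ` \<U>"
      then obtain U where "U \<in> \<U>" "Z = Z \<inter> P U"
        by auto
      then have "?X = ?X \<inter> U"
        by (auto simp: P_def)
      then have "?X \<in> (\<inter>) ?X ` \<U>"
        using \<open>U \<in> \<U>\<close> by (rule image_eqI)
      moreover have "?X \<notin> (\<inter>) ?X ` \<U>"
        using cover unfolding omega_cover_def by (rule conjunct2)
      ultimately show False
        by contradiction
    qed
  qed
  ultimately obtain \<W> where W: "\<W> \<subseteq> P ` \<U>" "gamma_cover Z \<W>"
    using Z \<open>countable \<U>\<close> unfolding borel_cover_gamma_set_def
    by (metis countable_image image_subsetI)
  \<comment> \<open>Different \<open>U\<close> may have the same pullback. Keeping one for each
    member of \<open>\<W>\<close> makes \<open>P\<close> injective on \<open>\<V>\<close>, so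
    finiteness carries back.\<close>
  then obtain \<V> where V: "\<V> \<subseteq> \<U>" "inj_on P \<V>" "\<W> = P ` \<V>"
    by (auto simp: subset_image_inj)
  have "gamma_cover ?X \<V>"
    unfolding gamma_cover_def
  proof (intro conjI ballI)
    show "infinite \<V>"
      using W V by (auto simp: gamma_cover_def)
    fix y assume "y \<in> ?X"
    then obtain i x where ix: "i \<in> I" "x \<in> Z" "y = g i x"
      by auto
    have "P ` {U \<in> \<V>. y \<notin> U} \<subseteq> {W \<in> \<W>. x \<notin> W}"
      using ix V by (auto simp: P_def)
    moreover have "finite {W \<in> \<W>. x \<notin> W}"
      using W ix by (auto simp: gamma_cover_def)
    ultimately have "finite (P ` {U \<in> \<V>. y \<notin> U})"
      by (rule finite_subset)
    then show "finite {U \<in> \<V>. y \<notin> U}"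
      using V(2) by (rule finite_imageD[OF _ inj_on_subset]) blast
  qed
  with V show "\<exists>\<V>\<subseteq>\<U>. gamma_cover ?X \<V>"
    by blast
qed

text \<open>
  The number \<open>n\<close> codes a finite list of bit strings, and \<open>n\<close> belongs to the set assigned to \<open>x\<close> if
  one of them is a prefix of \<open>x\<close>.
\<close>

definition indep :: "cantor \<Rightarrow> cantor" where
  "indep x n \<longleftrightarrow> (\<exists>xs \<in> set (from_nat n :: bool list list). \<forall>i<length xs. x i = xs ! i)"

text \<open>Choose for each pair of distinct points a coordinate where they differ; \<open>k\<close>
  bounds the finitely many coordinates chosen for pairs from \<open>F\<close>.\<close>

lemma finite_separating_prefix:
  fixes F :: "(nat \<Rightarrow> 'a) set"
  assumes "finite F"
  shows "\<exists>k. \<forall>x\<in>F. \<forall>y\<in>F. (\<forall>i<k. x i = y i) \<longrightarrow> x = y"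
proof -
  have "\<exists>i. x i \<noteq> y i" if "x \<noteq> y" for x y :: "nat \<Rightarrow> 'a"
    using that by auto
  then obtain d :: "(nat \<Rightarrow> 'a) \<Rightarrow> (nat \<Rightarrow> 'a) \<Rightarrow> nat"
    where d: "\<And>x y. x \<noteq> y \<Longrightarrow> x (d x y) \<noteq> y (d x y)"
    by metis
  have "finite (\<Union>x\<in>F. d x ` F)"
    using assms by auto
  then obtain k where "\<forall>i\<in>(\<Union>x\<in>F. d x ` F). i < k"
    using finite_nat_set_iff_bounded by blast
  then have "d x y < k" if "x \<in> F" "y \<in> F" for x y
    using that by blast
  with d show ?thesis
    by metis
qed

text \<open>Take \<open>n\<close> to code the prefixes of the points selected by \<open>s\<close>,
  long enough to tell the points of \<open>F\<close> apart.\<close>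

lemma indep_independent:
  assumes "finite F"
  shows "\<exists>n. \<forall>x\<in>F. indep x n \<longleftrightarrow> s x"
proof -
  obtain k where k: "\<forall>x\<in>F. \<forall>y\<in>F. (\<forall>i<k. x i = y i) \<longrightarrow> x = y"
    using finite_separating_prefix[OF assms] by blast
  have "finite ((\<lambda>x. map x [0..<k]) ` {x \<in> F. s x})"
    using assms by auto
  then obtain xss where xss: "set xss = (\<lambda>x. map x [0..<k]) ` {x \<in> F. s x}"
    using finite_list by blast
  have "indep x (to_nat xss) \<longleftrightarrow> s x" if "x \<in> F" for x
  proof -
    have "indep x (to_nat xss) \<longleftrightarrow> (\<exists>y\<in>F. s y \<and> (\<forall>i<k. x i = y i))"
      unfolding indep_def by (simp add: xss) blast
    with k that show ?thesis
      by blast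
  qed
  then show ?thesis
    by blast
qed

lemma open_coordinate_eq: "open {x :: cantor. x i = b}"
proof -
  have "open ((\<lambda>x :: cantor. x i) -` {b})"
    by (intro open_vimage open_discrete continuous_on_product_coordinates)
  then show ?thesis
    by (simp add: vimage_def)
qed

text \<open>The list coded by \<open>n\<close> is finite and consults finitely many coordinates, so
  membership of \<open>n\<close> is a clopen condition on \<open>x\<close>.\<close>

lemma continuous_indep: "continuous_on UNIV (\<lambda>x. indep x n)"
proof -
  let ?xss = "from_nat n :: bool list list"
  have "- {x :: cantor. x i = b} = {x. x i = (\<not> b)}" for i b
    by auto
  then have closed_coord: "closed {x :: cantor. x i = b}" for i b
    by (simp add: closed_def open_coordinate_eq)
  have eq: "{x. indep x n} = (\<Union>xs\<in>set ?xss. \<Inter>i\<in>{..<length xs}. {x. x i = xs ! i})"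
    by (auto simp: indep_def)
  have "open {x. indep x n}" "closed {x. indep x n}"
    unfolding eq using open_coordinate_eq closed_coord by (auto intro!: open_UN open_INT closed_UN closed_INT)
  then have "open {x. indep x n = b}" for b
    by (cases b) (simp_all add: closed_def Collect_neg_eq)
  moreover have "(\<lambda>x. indep x n) -` B = (\<Union>b\<in>B. {x. indep x n = b})" for B
    by auto
  ultimately have "open ((\<lambda>x. indep x n) -` B)" for B
    by (metis (no_types, lifting) open_UN)
  then show ?thesis
    by (simp add: continuous_on_open_vimage)
qed

text \<open>
  If no choice of signs makes the two differences infinite, one cell of each of the two diagonals
  of the partition of \<open>A\<close> by \<open>y\<close> and \<open>z\<close> is finite. These two cells agree in one coordinate, so
  \<open>y\<close> or \<open>z\<close>, suitably signed, meets \<open>A\<close> in a finite set.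
\<close>

lemma exists_signs:
  fixes y z :: cantor
  shows "\<exists>a b. finite {n \<in> A. y n = a} \<or> finite {n \<in> A. z n = b} \<or>
    infinite {n \<in> A. y n = a \<and> z n \<noteq> b} \<and> infinite {n \<in> A. y n \<noteq> a \<and> z n = b}"
proof -
  define c where "c a b = {n \<in> A. y n = a \<and> z n = b}" for a b
  have y: "{n \<in> A. y n = a} = c a True \<union> c a False" for a
    by (auto simp: c_def)
  have z: "{n \<in> A. z n = b} = c True b \<union> c False b" for b
    by (auto simp: c_def)
  have yz: "{n \<in> A. y n = a \<and> z n \<noteq> b} = c a (\<not> b)" "{n \<in> A. y n \<noteq> a \<and> z n = b} = c (\<not> a) b" for a b
    by (auto simp: c_def)
  show ?thesis
    unfolding y z yz by (simp add: ex_bool_eq) blast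
qed

lemma lepoll_bool_times_nat_set: "(UNIV :: (nat set \<times> bool) set) \<lesssim> (UNIV :: nat set set)"
proof -
  \<comment> \<open>The bit is stored at 0 and \<open>A\<close> is shifted up by one.\<close>
  have "inj (\<lambda>(A :: nat set, b). {n. if n = 0 then b else n - 1 \<in> A})"
  proof (rule injI, clarify)
    fix A A' :: "nat set" and b b'
    assume "{n. if n = 0 then b else n - 1 \<in> A} = {n. if n = 0 then b' else n - 1 \<in> A'}"
    then have *: "(if n = 0 then b else n - 1 \<in> A) = (if n = 0 then b' else n - 1 \<in> A')" for n
      by blast
    have "n \<in> A \<longleftrightarrow> n \<in> A'" for n
      using *[of "Suc n"] by simp
    then show "A = A' \<and> b = b'"
      using *[of 0] by auto
  qed
  then show ?thesis
    unfolding lepoll_def by blast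
qed

lemma borel_measurable_signed_indep: "(\<lambda>x n. indep x n = b) \<in> borel_measurable borel"
proof (intro borel_measurable_continuous_onI continuous_on_coordinatewise_then_product)
  fix n
  show "continuous_on UNIV (\<lambda>x. indep x n = b)"
    by (rule continuous_on_compose2[OF Topological_Spaces.continuous_on_discrete continuous_indep]) (rule subset_UNIV)
qed

theorem theorem1:
  assumes "\<exists>Z :: cantor set. borel_cover_gamma_set Z \<and> Z \<approx> (UNIV :: real set)"
  shows "\<exists>X Y :: cantor set.
           borel_cover_gamma_set X \<and> Y \<subseteq> X \<and> \<not> borel_cover_gamma_set Y \<and>
           (\<exists>\<U>. omega_cover Y \<U> \<and> (\<forall>U\<in>\<U>. open U) \<and> \<not> (\<exists>\<V>\<subseteq>\<U>. tau_cover Y \<V>))"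
proof -
  obtain Z :: "cantor set" where Z: "borel_cover_gamma_set Z" "Z \<approx> (UNIV :: real set)"
    using assms by blast
  have "infinite Z"
    using Z(2) eqpoll_finite_iff infinite_UNIV_char_0 by blast
  have "(UNIV :: (nat set \<times> bool) set) \<lesssim> Z"
    using lepoll_bool_times_nat_set nat_sets_eqpoll_reals Z(2)
    by (meson eqpoll_sym lepoll_trans1 lepoll_trans2)
  then obtain p :: "nat set \<times> bool \<Rightarrow> cantor" where p: "inj p" "range p \<subseteq> Z"
    by (auto simp: lepoll_def)
  \<comment> \<open>\<open>g True x\<close> is the member of the independent family at
    \<open>x\<close>, and \<open>g False x\<close> is its complement.\<close>
  define g where "g b x = (\<lambda>n. indep x n = b)" for b x
  \<comment> \<open>The first two alternatives violate the infinitude clause of a \<tau>-cover, the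
    last its comparability clause.\<close>
  define signs where "signs A a b \<longleftrightarrow> finite {n \<in> A. indep (p (A, True)) n = a} \<or>
      finite {n \<in> A. indep (p (A, False)) n = b} \<or>
      infinite {n \<in> A. indep (p (A, True)) n = a \<and> indep (p (A, False)) n \<noteq> b} \<and>
      infinite {n \<in> A. indep (p (A, True)) n \<noteq> a \<and> indep (p (A, False)) n = b}" for A a b
  have "\<exists>a b. signs A a b" for A
    unfolding signs_def by (rule exists_signs)
  then obtain a b where ab: "\<And>A. signs A (a A) (b A)"
    by metis
  \<comment> \<open>Outside \<open>range p\<close> the value of \<open>inv p\<close> is unspecified;
    any sign works there.\<close>
  define s where "s x = (case inv p x of (A, c) \<Rightarrow> if c then a A else b A)" for x
  have s: "s (p (A, True)) = a A" "s (p (A, False)) = b A" for A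
    using p(1) by (simp_all add: s_def)
  define X where "X = (\<Union>b\<in>UNIV. g b ` Z)"
  define Y where "Y = (\<lambda>x. g (s x) x) ` Z"
  define U where "U n = {y :: cantor. y n}" for n
  \<comment> \<open>Injectivity lets subfamilies be treated as sets of indices.\<close>
  have "inj U"
  proof (rule injI)
    fix m n assume "U m = U n"
    then have "(\<lambda>i. i = m) \<in> U n"
      by (auto simp: U_def)
    then show "m = n"
      by (simp add: U_def)
  qed
  have "borel_cover_gamma_set X"
    unfolding X_def using borel_measurable_signed_indep
    by (intro borel_cover_gamma_set_finite_UN_image Z(1)) (auto simp: g_def[abs_def])
  moreover have "Y \<subseteq> X"
    by (auto simp: X_def Y_def)
  moreover have U_open: "open (U n)" for n
    using open_coordinate_eq[of n True] by (simp add: U_def)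
  \<comment> \<open>Sets containing \<open>Y\<close> are discarded, as their trace would be
    \<open>Y\<close> itself.\<close>
  define \<U> where "\<U> = {V \<in> range U. \<not> Y \<subseteq> V}"
  have omega: "omega_cover Y \<U>"
    unfolding omega_cover_def
  proof (intro conjI allI impI)
    fix F assume "finite F \<and> F \<subseteq> Y"
    then obtain H where H: "H \<subseteq> Z" "finite H" "F = (\<lambda>x. g (s x) x) ` H"
      unfolding Y_def by (meson finite_subset_image)
    obtain z where z: "z \<in> Z" "z \<notin> H"
      using \<open>infinite Z\<close> H by (metis finite_subset subsetI)
    \<comment> \<open>The additional point \<open>z\<close> witnesses that the chosen member does not cover \<open>Y\<close>.\<close>
    obtain n where n: "\<forall>x\<in>insert z H. indep x n \<longleftrightarrow> (s x \<longleftrightarrow> x \<noteq> z)"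
      using indep_independent[of "insert z H" "\<lambda>x. s x \<longleftrightarrow> x \<noteq> z"] H by auto
    have "F \<subseteq> U n"
      using n z H by (auto simp: U_def g_def)
    moreover have "g (s z) z \<notin> U n"
      using n by (auto simp: U_def g_def)
    ultimately show "\<exists>V\<in>\<U>. F \<subseteq> V"
      using z by (auto simp: \<U>_def Y_def)
  qed (auto simp: \<U>_def)
  have no_tau: "\<not> tau_cover Y \<V>" if "\<V> \<subseteq> \<U>" for \<V>
  proof
    assume tau: "tau_cover Y \<V>"
    define A where "A = {n. U n \<in> \<V>}"
    have "\<V> = U ` A"
      using that by (auto simp: A_def \<U>_def)
    have eq: "finite {V \<in> \<V>. P V} \<longleftrightarrow> finite {n \<in> A. P (U n)}" for P
    proof -
      have "{V \<in> \<V>. P V} = U ` {n \<in> A. P (U n)}"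
        using \<open>\<V> = U ` A\<close> by auto
      moreover have "inj_on U {n \<in> A. P (U n)}"
        using \<open>inj U\<close> by (rule inj_on_subset) (rule subset_UNIV)
      ultimately show ?thesis
        by (simp add: finite_image_iff)
    qed
    have tau': "\<forall>x\<in>Y. infinite {n \<in> A. x n}"
      "\<forall>x\<in>Y. \<forall>y\<in>Y. finite {n \<in> A. x n \<and> \<not> y n} \<or> finite {n \<in> A. \<not> x n \<and> y n}"
      using tau unfolding tau_cover_def eq by (simp_all add: U_def)
    \<comment> \<open>Diagonal step: the two points reserved for this very \<open>A\<close> refute
      \<open>tau'\<close>.\<close>
    have "g (s (p (A, c))) (p (A, c)) \<in> Y" for c
      unfolding Y_def using p(2) by (intro imageI) blast
    from this[of True] this[of False]
    have *: "g (a A) (p (A, True)) \<in> Y" "g (b A) (p (A, False)) \<in> Y"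
      by (simp_all add: s)
    show False
      using tau'(1)[rule_format, OF *(1)] tau'(1)[rule_format, OF *(2)]
        tau'(2)[rule_format, OF *] ab[of A]
      by (simp add: g_def signs_def)
  qed
  \<comment> \<open>The family \<open>\<U>\<close> is countable and open, and a \<gamma>-subcover
    would be a \<tau>-subcover.\<close>
  moreover have "\<not> borel_cover_gamma_set Y"
  proof
    assume "borel_cover_gamma_set Y"
    moreover have "countable \<U>" "\<U> \<subseteq> sets borel"
      using U_open by (auto simp: \<U>_def)
    ultimately obtain \<V> where "\<V> \<subseteq> \<U>" "gamma_cover Y \<V>"
      using omega unfolding borel_cover_gamma_set_def by blast
    then show False
      using no_tau gamma_cover_imp_tau_cover by blast
  qed
  moreover have "\<forall>V\<in>\<U>. open V"
    using U_open by (auto simp: \<U>_def)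
  ultimately show ?thesis
    using omega by blast
qed

end
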